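(* Let $A_1,\dots,A_n$ be the vertices of a regular octahedron ($n=6$) or of a cube ($n=8$) in Euclidean $3$-space with circumradius $R>0$. Let $m\in\{2,3\}$ and let $c$ be a real constant with $c>nR^{2m}$. Then the locus of points $M$ in the space such that $$\sum_{i=1}^n d_i^{2m}=c,\qquad d_i=|MA_i|,$$ is a sphere whose center is the centroid of the solid.
   Context: $|MA_i|$ denotes Euclidean distance. A sphere means a sphere of positive radius. *)

theory Defs
  imports "HOL-Analysis.Analysis"
begin

definition vertices :: "'a::euclidean_space set \<Rightarrow> 'a set" where
  "vertices S = {v. v extreme_point_of S}"

definition similarity :: "('a::metric_space \<Rightarrow> 'b::metric_space) \<Rightarrow> bool" where
  "similarity f \<longleftrightarrow> (\<exists>k>0. \<forall>x y. dist (f x) (f y) = k * dist x y)"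

text \<open>The solids are the full bodies, in arbitrary position, orientation and size.
  \<open>Basis\<close> consists of the three standard unit vectors, and \<open>One\<close> is their sum.\<close>

definition regular_octahedron :: "(real^3) set \<Rightarrow> bool" where
  "regular_octahedron S \<longleftrightarrow>
     (\<exists>f :: real^3 \<Rightarrow> real^3. similarity f \<and> S = f ` (convex hull (Basis \<union> uminus ` Basis)))"

definition cube :: "(real^3) set \<Rightarrow> bool" where
  "cube S \<longleftrightarrow> (\<exists>f :: real^3 \<Rightarrow> real^3. similarity f \<and> S = f ` cbox 0 One)"

text \<open>For a full-dimensional polytope the circumscribed sphere, if there is one, is unique,
  so at most one nonnegative \<open>R\<close> satisfies the following predicate.\<close>

definition has_circumradius :: "'a::euclidean_space set \<Rightarrow> real \<Rightarrow> bool" where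
  "has_circumradius S R \<longleftrightarrow> (\<exists>p. vertices S \<subseteq> sphere p R)"

text \<open>The centre of mass of the body \<open>S\<close> with uniform density.\<close>

definition centroid :: "'a::euclidean_space set \<Rightarrow> 'a" where
  "centroid S = (1 / measure lebesgue S) *\<^sub>R integral S (\<lambda>x. x)"

end

theory Submission
  imports Defs
begin

text \<open>After translating its centre to the origin, the vertex set \<open>V\<close> of either solid is centrally
  symmetric and satisfies \<open>(\<Sum>v\<in>V. (u \<bullet> v)\<^sup>2) = K * (norm u)\<^sup>2\<close> for all \<open>u\<close>. In
  \<open>\<Sum>v\<in>V. dist w v ^ (2 * m) = (\<Sum>v\<in>V. ((norm w)\<^sup>2 + R\<^sup>2 - 2 * (w \<bullet> v)) ^ m)\<close> only the moments of
  \<open>w \<bullet> v\<close> of order at most 3 occur; the odd ones vanish and the second is \<open>K * (norm w)\<^sup>2\<close>.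
  Hence the sum is a strictly increasing function of \<open>norm w\<close> with value \<open>n * R ^ (2 * m)\<close> at the centre.\<close>

section \<open>Symmetric tight frames and their basic properties\<close>

definition symmetric_tight_frame :: "real \<Rightarrow> 'a::euclidean_space set \<Rightarrow> bool" where
  "symmetric_tight_frame K V \<longleftrightarrow> finite V \<and> uminus ` V = V \<and> K > 0 \<and>
     (\<forall>u. (\<Sum>v\<in>V. (u \<bullet> v)\<^sup>2) = K * (norm u)\<^sup>2)"

lemma symmetric_tight_frameD:
  assumes "symmetric_tight_frame K V"
  shows "finite V" "uminus ` V = V" "K > 0" "(\<Sum>v\<in>V. (u \<bullet> v)\<^sup>2) = K * (norm u)\<^sup>2"
    "v \<in> V \<Longrightarrow> - v \<in> V"
  using assms unfolding symmetric_tight_frame_def by auto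

text \<open>The frame identity leaves \<open>K * (norm u)\<^sup>2 = 0\<close>, and
  \<open>K > 0\<close>. This is how spanning of the space enters: it gives the hull positive volume,
  pins down the circumcentre and makes \<open>V\<close> nonempty.\<close>

lemma symmetric_tight_frame_separates:
  assumes "symmetric_tight_frame K V" and "\<And>v. v \<in> V \<Longrightarrow> u \<bullet> v = 0"
  shows "u = 0"
  using symmetric_tight_frameD(3)[OF assms(1)] symmetric_tight_frameD(4)[OF assms(1), of u] assms(2)
  by simp

lemma sum_symmetric_odd:
  fixes f :: "'a::euclidean_space \<Rightarrow> real"
  assumes "uminus ` V = V" and "\<And>v. f (- v) = - f v"
  shows "sum f V = 0"
proof -
  have "sum f V = sum f (uminus ` V)" using assms(1) by simp
  also have "\<dots> = (\<Sum>v\<in>V. f (- v))" by (simp add: sum.reindex)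
  also have "\<dots> = - sum f V" by (simp add: assms(2) sum_negf)
  finally show ?thesis by simp
qed

section \<open>Vertices, centroid and circumcentre of the hull\<close>

text \<open>Balls are strictly convex: a point strictly between two points of
  \<open>cball p r\<close> is closer to \<open>p\<close> than one of them, so it cannot lie on the
  sphere.\<close>

lemma extreme_points_of_convex_hull_sphere:
  fixes V :: "'a::euclidean_space set"
  assumes "V \<subseteq> sphere p r"
  shows "{x. x extreme_point_of convex hull V} = V"
proof
  show "{x. x extreme_point_of convex hull V} \<subseteq> V"
    using extreme_point_of_convex_hull by blast
  have hull: "convex hull V \<subseteq> cball p r"
    using assms by (intro hull_minimal) (auto simp: sphere_def)
  show "V \<subseteq> {x. x extreme_point_of convex hull V}"
  proof
    fix v assume v: "v \<in> V"
    have False if "a \<in> convex hull V" "b \<in> convex hull V" "v \<in> open_segment a b" for a b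
      using dist_decreases_open_segment[OF that(3), of p] that(1,2) hull assms v by force
    then show "v \<in> {x. x extreme_point_of convex hull V}"
      using v by (auto simp: extreme_point_of_def hull_inc)
  qed
qed

text \<open>The reflection in \<open>q\<close> preserves \<open>S\<close> and Lebesgue measure but
  negates \<open>x - q\<close>, so the first moment \<open>J\<close> about \<open>q\<close> equals
  \<open>- J\<close>.\<close>

lemma centroid_centrally_symmetric:
  fixes S :: "'a::euclidean_space set"
  assumes "compact S" and pos: "measure lebesgue S \<noteq> 0"
    and sym: "\<And>x. x \<in> S \<Longrightarrow> 2 *\<^sub>R q - x \<in> S"
  shows "centroid S = q"
proof -
  have int: "f integrable_on S" if "continuous_on S f" for f :: "'a \<Rightarrow> 'a"
    using set_borel_integral_eq_integral(1)[of S f] borel_integrable_compact[OF assms(1) that]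
    by (auto simp: set_integrable_def)
  \<comment> \<open>Extending by zero moves the integral to a box centred at \<open>q\<close>, which
    the reflection maps onto itself; the affine change of variables is applied there.\<close>
  define f where "f x = (if x \<in> S then x - q else 0)" for x
  define J where "J = integral S (\<lambda>x. x - q)"
  have "bounded ((\<lambda>x. x - q) ` S)"
    using compact_imp_bounded[OF assms(1)] by (simp add: bounded_translation_minus)
  then obtain a where a: "(\<lambda>x. x - q) ` S \<subseteq> cbox (- a) a"
    using bounded_subset_cbox_symmetric by blast
  have "x \<in> (+) q ` cbox (- a) a" if "x \<in> S" for x
    using a that by (intro image_eqI[of _ _ "x - q"]) auto
  then have box: "S \<subseteq> cbox (q - a) (q + a)"
    using cbox_translation[of q "- a" a] by auto
  have J: "((\<lambda>x. x - q) has_integral J) S"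
    unfolding J_def by (intro integrable_integral int continuous_intros)
  then have fJ: "(f has_integral J) (cbox (q - a) (q + a))"
    using box has_integral_restrict[OF box, of "\<lambda>x. x - q" J] by (simp add: f_def[abs_def])
  have img: "(\<lambda>x. 2 *\<^sub>R q - x) ` cbox (q - a) (q + a) = cbox (q - a) (q + a)"
  proof -
    have sub: "2 *\<^sub>R q - x \<in> cbox (q - a) (q + a)" if "x \<in> cbox (q - a) (q + a)" for x
      using that by (force simp: mem_box algebra_simps)
    then show ?thesis
      by (auto intro!: image_eqI[of x "\<lambda>x. 2 *\<^sub>R q - x" "2 *\<^sub>R q - x" for x])
  qed
  have "((\<lambda>x. f (2 *\<^sub>R q - x)) has_integral J) (cbox (q - a) (q + a))"
    using has_integral_affinity[OF fJ, of "-1" "2 *\<^sub>R q"] img by simp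
  moreover have "f (2 *\<^sub>R q - x) = - f x" for x
  proof -
    have "2 *\<^sub>R q - x \<in> S \<longleftrightarrow> x \<in> S" using sym[of x] sym[of "2 *\<^sub>R q - x"] by auto
    then show ?thesis by (simp add: f_def scaleR_2)
  qed
  ultimately have "((\<lambda>x. - f x) has_integral J) (cbox (q - a) (q + a))" by simp
  with has_integral_neg[OF fJ] have "J = - J" by (metis has_integral_unique)
  then have "2 *\<^sub>R J = 0" by (metis add.left_inverse scaleR_2)
  then have "J = 0" by simp
  have "S \<in> lmeasurable" using assms(1) by (rule lmeasurable_compact)
  then have "((\<lambda>x. q) has_integral measure lebesgue S *\<^sub>R q) S"
    using has_integral_scaleR_left[of "\<lambda>x. 1::real" "measure lebesgue S" S q]
    by (simp add: lmeasure_integral lmeasurable_iff_integrable_on integrable_integral)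
  from has_integral_add[OF J this] have "integral S (\<lambda>x. x) = measure lebesgue S *\<^sub>R q"
    using \<open>J = 0\<close> by (simp add: integral_unique)
  then show ?thesis using pos by (simp add: centroid_def)
qed

lemma centroid_symmetric_tight_frame:
  fixes q :: "'a::euclidean_space"
  assumes V: "symmetric_tight_frame K V"
  shows "centroid (convex hull ((+) q ` V)) = q"
proof (rule centroid_centrally_symmetric)
  let ?S = "convex hull ((+) q ` V)"
  show compact: "compact ?S"
    using symmetric_tight_frameD(1)[OF V] by (simp add: finite_imp_compact_convex_hull)
  have refl: "(\<lambda>x. 2 *\<^sub>R q - x) ` (+) q ` V = (+) q ` V"
  proof -
    have "(\<lambda>x. 2 *\<^sub>R q - x) ` (+) q ` V = (+) q ` uminus ` V"
      by (simp add: image_image scaleR_2)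
    then show ?thesis using symmetric_tight_frameD(2)[OF V] by simp
  qed
  have "(\<lambda>x. 2 *\<^sub>R q - x) ` ?S = ?S"
    using convex_hull_affinity[of "2 *\<^sub>R q" "-1" "(+) q ` V"] refl by simp
  then show "2 *\<^sub>R q - x \<in> ?S" if "x \<in> ?S" for x using that by blast
  \<comment> \<open>If the interior were empty, the hull would lie in a hyperplane with normal
    \<open>a\<close>. Comparing \<open>q + v\<close> with \<open>q - v\<close> makes
    \<open>a\<close> orthogonal to the whole frame.\<close>
  have "interior ?S \<noteq> {}"
  proof
    assume "interior ?S = {}"
    then obtain a b where "a \<noteq> 0" and ab: "?S \<subseteq> {x. a \<bullet> x = b}"
      using empty_interior_subset_hyperplane[of ?S] by auto
    have eq: "a \<bullet> q + a \<bullet> v = b" if "v \<in> V" for v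
    proof -
      have "q + v \<in> ?S" using that by (auto intro: hull_inc)
      then show ?thesis using ab by (auto simp: inner_add_right)
    qed
    have "a \<bullet> v = 0" if "v \<in> V" for v
      using eq[OF that] eq[OF symmetric_tight_frameD(5)[OF V that]] by simp
    then show False using symmetric_tight_frame_separates[OF V] \<open>a \<noteq> 0\<close> by blast
  qed
  then show "measure lebesgue ?S \<noteq> 0"
    using negligible_iff_measure0[OF lmeasurable_compact[OF compact]]
    by (simp add: negligible_convex_interior)
qed

text \<open>The circumcentre \<open>p\<close> is not known in advance. Equal distances from
  \<open>p\<close> to \<open>q + v\<close> and \<open>q - v\<close> make \<open>p - q\<close>
  orthogonal to every \<open>v\<close>, so \<open>p = q\<close>.\<close>

lemma norm_symmetric_tight_frame_in_sphere:
  fixes q :: "'a::euclidean_space"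
  assumes V: "symmetric_tight_frame K V" and S: "(+) q ` V \<subseteq> sphere p R" and "v \<in> V"
  shows "norm v = R"
proof -
  have *: "norm (p - q - v) = R" if "v \<in> V" for v
    using S that by (auto simp: dist_norm diff_diff_eq)
  have "(p - q) \<bullet> v = 0" if "v \<in> V" for v
  proof -
    have "norm (p - q - v) = norm (p - q + v)"
      using *[OF that] *[OF symmetric_tight_frameD(5)[OF V that]] by simp
    then have "(p - q - v) \<bullet> (p - q - v) = (p - q + v) \<bullet> (p - q + v)"
      by (simp add: norm_eq)
    then show ?thesis by (simp add: inner_simps inner_commute)
  qed
  then have "p - q = 0" using symmetric_tight_frame_separates[OF V] by blast
  then show ?thesis using *[OF \<open>v \<in> V\<close>] by simp
qed

section \<open>Power sums of distances and their level sets\<close>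

text \<open>The terms \<open>4 * K * t\<close> and \<open>12 * K * t * (t + R\<^sup>2)\<close> come
  from the quadratic terms of the square and cube of \<open>s - 2 * (w \<bullet> v)\<close>. A
  fourth power would involve the fourth moment, which the frame identity does not determine.\<close>

lemma
  fixes w :: "'a::euclidean_space" and t :: real
  assumes V: "symmetric_tight_frame K V" and R: "\<And>v. v \<in> V \<Longrightarrow> norm v = R"
  defines "t \<equiv> (norm w)\<^sup>2"
  shows sum_dist_power4_symmetric_tight_frame:
      "(\<Sum>v\<in>V. dist w v ^ 4) = card V * (t + R\<^sup>2)\<^sup>2 + 4 * K * t"
    and sum_dist_power6_symmetric_tight_frame:
      "(\<Sum>v\<in>V. dist w v ^ 6) = card V * (t + R\<^sup>2) ^ 3 + 12 * K * t * (t + R\<^sup>2)"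
proof -
  define s where "s = t + R\<^sup>2"
  have d: "(dist w v)\<^sup>2 = s - 2 * (w \<bullet> v)" if "v \<in> V" for v
    unfolding s_def t_def dist_norm R[OF that, symmetric]
    by (simp add: power2_norm_eq_inner inner_simps inner_commute)
  have odd1: "(\<Sum>v\<in>V. w \<bullet> v) = 0" and odd3: "(\<Sum>v\<in>V. (w \<bullet> v) ^ 3) = 0"
    by (rule sum_symmetric_odd[OF symmetric_tight_frameD(2)[OF V]]; simp)+
  note second = symmetric_tight_frameD(4)[OF V, of w, folded t_def]
  have "(\<Sum>v\<in>V. dist w v ^ 4) = (\<Sum>v\<in>V. ((dist w v)\<^sup>2)\<^sup>2)" by simp
  also have "\<dots> = (\<Sum>v\<in>V. s\<^sup>2 - 4 * s * (w \<bullet> v) + 4 * (w \<bullet> v)\<^sup>2)"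
    by (intro sum.cong refl) (simp only: d, simp add: power2_eq_square algebra_simps)
  also have "\<dots> = card V * s\<^sup>2 + 4 * K * t"
    by (simp add: sum.distrib sum_subtractf odd1 second flip: sum_distrib_left)
  finally show "(\<Sum>v\<in>V. dist w v ^ 4) = card V * (t + R\<^sup>2)\<^sup>2 + 4 * K * t" by (simp add: s_def)
  have "(\<Sum>v\<in>V. dist w v ^ 6) = (\<Sum>v\<in>V. ((dist w v)\<^sup>2) ^ 3)" by (simp flip: power_mult)
  also have "\<dots> = (\<Sum>v\<in>V. s ^ 3 - 6 * s\<^sup>2 * (w \<bullet> v) + 12 * s * (w \<bullet> v)\<^sup>2 - 8 * (w \<bullet> v) ^ 3)"
    by (intro sum.cong refl) (simp only: d, simp add: power2_eq_square power3_eq_cube algebra_simps)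
  also have "\<dots> = card V * s ^ 3 + 12 * K * t * s"
    by (simp add: sum.distrib sum_subtractf odd1 odd3 second flip: sum_distrib_left)
  finally show "(\<Sum>v\<in>V. dist w v ^ 6) = card V * (t + R\<^sup>2) ^ 3 + 12 * K * t * (t + R\<^sup>2)"
    by (simp add: s_def)
qed

text \<open>The intermediate value theorem on \<open>{0..T}\<close> yields a squared radius
  \<open>t\<close>, strict monotonicity makes it unique, and \<open>F 0 < c\<close> rules out
  \<open>t = 0\<close>.\<close>

lemma level_set_eq_sphere:
  fixes q :: "'a::euclidean_space" and F :: "real \<Rightarrow> real"
  assumes F: "\<And>M. G M = F ((dist M q)\<^sup>2)" and cont: "continuous_on {0..} F"
    and mono: "strict_mono_on {0..} F" and "F 0 < c" and "0 \<le> T" and "c \<le> F T"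
  shows "\<exists>r>0. {M. G M = c} = sphere q r"
proof -
  have "continuous_on {0..T} F" using cont by (rule continuous_on_subset) auto
  then obtain t where t: "0 \<le> t" "F t = c"
    using IVT'[of F 0 c T] assms(4-6) by auto
  then have "t > 0" using \<open>F 0 < c\<close> by (cases "t = 0") auto
  have "G M = c \<longleftrightarrow> dist q M = sqrt t" for M
  proof -
    have "G M = c \<longleftrightarrow> (dist M q)\<^sup>2 = t"
      using strict_mono_on_eqD[OF mono, of "(dist M q)\<^sup>2" t] t by (auto simp: F)
    then show ?thesis
      using \<open>0 \<le> t\<close> by (metis dist_commute real_sqrt_pow2 real_sqrt_unique zero_le_dist)
  qed
  then have "{M. G M = c} = sphere q (sqrt t)" by (simp add: sphere_def)
  moreover have "sqrt t > 0" using \<open>t > 0\<close> by simp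
  ultimately show ?thesis by blast
qed

lemma level_set_symmetric_tight_frame:
  fixes q :: "'a::euclidean_space"
  assumes V: "symmetric_tight_frame K V" and R: "\<And>v. v \<in> V \<Longrightarrow> norm v = R"
    and m: "m \<in> {2, 3::nat}" and c: "c > real (card V) * R ^ (2 * m)"
  shows "\<exists>r>0. {M. (\<Sum>v\<in>V. dist M (q + v) ^ (2 * m)) = c} = sphere q r"
proof -
  have "V \<noteq> {}"
  proof
    assume "V = {}"
    then have "b = 0" if "b \<in> Basis" for b :: 'a
      using symmetric_tight_frame_separates[OF V, of b] by simp
    then show False using nonempty_Basis nonzero_Basis by blast
  qed
  then have n: "real (card V) \<ge> 1"
    using symmetric_tight_frameD(1)[OF V] by (simp add: Suc_le_eq card_gt_0_iff)
  note K = symmetric_tight_frameD(3)[OF V]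
  have shift: "dist M (q + v) = dist (M - q) v" for M v by (simp add: dist_norm diff_diff_eq)
  \<comment> \<open>Here \<open>t\<close> is the squared distance to \<open>q\<close>; the
    conditional term is the second-moment contribution for \<open>m = 2\<close> and
    \<open>m = 3\<close>.\<close>
  define F where "F t = card V * (t + R\<^sup>2) ^ m
      + (if m = 2 then 4 * K * t else 12 * K * t * (t + R\<^sup>2))" for t
  \<comment> \<open>Taking \<open>T \<ge> 1\<close> ensures \<open>T \<le> T ^ m\<close>, hence
    \<open>c \<le> T \<le> T ^ m \<le> F T\<close>.\<close>
  define T where "T = max 1 c"
  show ?thesis
  proof (rule level_set_eq_sphere)
    show "(\<Sum>v\<in>V. dist M (q + v) ^ (2 * m)) = F ((dist M q)\<^sup>2)" for M
      using m sum_dist_power4_symmetric_tight_frame[OF V R, of "M - q"]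
        sum_dist_power6_symmetric_tight_frame[OF V R, of "M - q"]
      by (auto simp: shift F_def dist_norm[of M q])
    show "continuous_on {0..} F"
      unfolding F_def by (cases "m = 2") (auto intro!: continuous_intros)
    show "strict_mono_on {0..} F"
    proof (rule strict_mono_onI)
      fix r s :: real assume rs: "r \<in> {0..}" "s \<in> {0..}" "r < s"
      \<comment> \<open>Strictness comes from the leading term, as \<open>card V \<ge> 1\<close>;
        the second-moment term only has to be weakly increasing.\<close>
      have "(r + R\<^sup>2) ^ m < (s + R\<^sup>2) ^ m" using rs m by (intro power_strict_mono) auto
      then have "card V * (r + R\<^sup>2) ^ m < card V * (s + R\<^sup>2) ^ m" using n by simp
      moreover have "12 * K * r * (r + R\<^sup>2) \<le> 12 * K * s * (s + R\<^sup>2)"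
        using rs K by (intro mult_mono) auto
      ultimately show "F r < F s" using rs K by (auto simp: F_def intro!: add_less_le_mono)
    qed
    show "F 0 < c" using c m by (auto simp: F_def)
    have T: "1 \<le> T" "c \<le> T" by (simp_all add: T_def)
    then show "0 \<le> T" by simp
    note T(2)
    also have "T \<le> T ^ m" using m T(1) by (intro self_le_power) auto
    also have "\<dots> \<le> (T + R\<^sup>2) ^ m" using T(1) by (intro power_mono) auto
    also have "\<dots> \<le> card V * (T + R\<^sup>2) ^ m"
      using mult_right_mono[OF n, of "(T + R\<^sup>2) ^ m"] T(1) by simp
    also have "\<dots> \<le> F T" using K T(1) by (simp add: F_def)
    finally show "c \<le> F T" .
  qed
qed

section \<open>Transport along similarities\<close>

text \<open>Similarities are defined by distances alone. Subtracting \<open>f 0\<close> and dividing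
  by \<open>k\<close> leaves an isometry fixing the origin, which is orthogonal.\<close>

lemma similarity_affine:
  fixes f :: "real^'n \<Rightarrow> real^'n"
  assumes "similarity f"
  obtains k g where "k > 0" "orthogonal_transformation g" "\<And>x. f x = f 0 + k *\<^sub>R g x"
proof -
  obtain k where k: "k > 0" "\<And>x y. dist (f x) (f y) = k * dist x y"
    using assms unfolding similarity_def by blast
  define g where "g x = (1 / k) *\<^sub>R (f x - f 0)" for x
  have "dist (g x) (g y) = dist x y" for x y
  proof -
    have "g x - g y = (1 / k) *\<^sub>R (f x - f y)" by (simp add: g_def algebra_simps)
    then show ?thesis using k by (simp add: dist_norm)
  qed
  moreover have "g 0 = 0" by (simp add: g_def)
  ultimately have "orthogonal_transformation g"
    by (simp add: orthogonal_transformation_isometry)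
  then show thesis using that[of k g] k(1) by (simp add: g_def)
qed

lemma symmetric_tight_frame_scaled_orthogonal_image:
  fixes g :: "'a::euclidean_space \<Rightarrow> 'a"
  assumes V: "symmetric_tight_frame K V" and g: "orthogonal_transformation g" and "k > 0"
  shows "symmetric_tight_frame (k\<^sup>2 * K) ((\<lambda>x. k *\<^sub>R g x) ` V)"
proof -
  have lin: "linear g" using g by (rule orthogonal_transformation_linear)
  have inj: "inj_on (\<lambda>x. k *\<^sub>R g x) V"
    using orthogonal_transformation_inj[OF g] \<open>k > 0\<close> by (auto simp: inj_on_def)
  have "uminus ` (\<lambda>x. k *\<^sub>R g x) ` V = (\<lambda>x. k *\<^sub>R g x) ` uminus ` V"
    by (simp add: image_image linear_neg[OF lin])
  moreover have "(\<Sum>v\<in>(\<lambda>x. k *\<^sub>R g x) ` V. (u \<bullet> v)\<^sup>2) = k\<^sup>2 * K * (norm u)\<^sup>2" for u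
  proof -
    \<comment> \<open>Writing \<open>u = g u'\<close> lets orthogonality remove \<open>g\<close>
      from every inner product.\<close>
    obtain u' where u: "u = g u'" using orthogonal_transformation_surj[OF g] by (metis surjD)
    have "(\<Sum>v\<in>(\<lambda>x. k *\<^sub>R g x) ` V. (u \<bullet> v)\<^sup>2) = (\<Sum>x\<in>V. (u \<bullet> (k *\<^sub>R g x))\<^sup>2)"
      using inj by (simp add: sum.reindex)
    also have "\<dots> = k\<^sup>2 * (\<Sum>x\<in>V. (u' \<bullet> x)\<^sup>2)"
      using g by (simp add: u orthogonal_transformation_def power_mult_distrib sum_distrib_left)
    also have "\<dots> = k\<^sup>2 * K * (norm u)\<^sup>2"
      using symmetric_tight_frameD(4)[OF V, of u'] orthogonal_transformation_norm[OF g, of u']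
      by (simp add: u)
    finally show ?thesis .
  qed
  ultimately show ?thesis
    using symmetric_tight_frameD(1-3)[OF V] \<open>k > 0\<close> by (simp add: symmetric_tight_frame_def)
qed

text \<open>Reduces a solid in arbitrary position to a translated frame. The shift \<open>p\<close>
  admits model bodies not centred at the origin; the common radius \<open>r\<close> makes all frame
  points extreme. The new centre is \<open>f p\<close>.\<close>

lemma similarity_image_symmetric_tight_frame:
  fixes f :: "real^'n \<Rightarrow> real^'n"
  assumes "similarity f" and V: "symmetric_tight_frame K V" and r: "V \<subseteq> sphere 0 r"
    and S: "S = f ` (convex hull ((+) p ` V))"
  obtains K' W q where "symmetric_tight_frame K' W" "S = convex hull ((+) q ` W)"
    "vertices S = (+) q ` W"
proof -
  obtain k g where k: "k > 0" and g: "orthogonal_transformation g"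
    and f: "\<And>x. f x = f 0 + k *\<^sub>R g x"
    using similarity_affine[OF assms(1)] by blast
  have lin: "linear g" using g by (rule orthogonal_transformation_linear)
  define W where "W = (\<lambda>x. k *\<^sub>R g x) ` V"
  have f_image: "f ` X = (\<lambda>x. f 0 + k *\<^sub>R x) ` g ` X" for X
    unfolding image_image by (intro image_cong refl f)
  have fp: "f (p + x) = f p + k *\<^sub>R g x" for x
    using f[of "p + x"] f[of p] by (simp add: linear_add[OF lin] scaleR_add_right)
  have "S = convex hull (f ` (+) p ` V)"
    unfolding S f_image convex_hull_affinity convex_hull_linear_image[OF lin] ..
  also have "f ` (+) p ` V = (+) (f p) ` W"
    by (simp add: W_def image_image fp)
  finally have hull: "S = convex hull ((+) (f p) ` W)" .
  have "(+) (f p) ` W \<subseteq> sphere (f p) (k * r)"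
    using r k orthogonal_transformation_norm[OF g] by (auto simp: W_def dist_norm)
  then have "vertices S = (+) (f p) ` W"
    unfolding hull vertices_def by (rule extreme_points_of_convex_hull_sphere)
  with that[OF symmetric_tight_frame_scaled_orthogonal_image[OF V g k, folded W_def] hull]
  show thesis .
qed

section \<open>The frames of the octahedron and the cube\<close>

text \<open>Each squared coordinate of \<open>u\<close> occurs twice, once for \<open>b\<close> and
  once for \<open>- b\<close>, whence \<open>K = 2\<close>.\<close>

lemma symmetric_tight_frame_octahedron:
  "symmetric_tight_frame 2 (Basis \<union> uminus ` Basis :: 'a::euclidean_space set)"
proof -
  have disj: "Basis \<inter> uminus ` Basis = ({} :: 'a set)"
  proof -
    \<comment> \<open>The inner product of \<open>b\<close> and \<open>- b\<close> is
      \<open>- 1\<close>, whereas basis vectors have inner product 0 or 1.\<close>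
    have False if "b \<in> Basis" "- b \<in> Basis" for b :: 'a
      using inner_Basis[OF that] that inner_same_Basis[OF that(1)] by (auto split: if_splits)
    then show ?thesis by auto
  qed
  have "(\<Sum>v\<in>Basis \<union> uminus ` Basis. (u \<bullet> v)\<^sup>2) = 2 * (norm u)\<^sup>2" for u :: 'a
  proof -
    have "(\<Sum>v\<in>Basis \<union> uminus ` Basis. (u \<bullet> v)\<^sup>2) = 2 * (\<Sum>b\<in>Basis. (u \<bullet> b)\<^sup>2)"
      using disj by (simp add: sum.union_disjoint sum.reindex)
    also have "(\<Sum>b\<in>Basis. (u \<bullet> b)\<^sup>2) = (norm u)\<^sup>2"
      unfolding power2_norm_eq_inner euclidean_inner[of u u] by (simp add: power2_eq_square)
    finally show ?thesis .
  qed
  then show ?thesis by (auto simp: symmetric_tight_frame_def image_Un image_image)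
qed

text \<open>Vertices of the unit cube, recentred at the origin to be centrally symmetric.\<close>

definition cube_frame :: "(real^3) set" where
  "cube_frame = {x. \<forall>i. x $ i = 1/2 \<or> x $ i = - 1/2}"

text \<open>An explicit enumeration that lets finiteness and sums over the eight vectors be
  computed.\<close>

lemma cube_frame_eq:
  "cube_frame = (\<lambda>(a, b, c). vector [a, b, c]) ` ({1/2, - 1/2} \<times> {1/2, - 1/2} \<times> {1/2, - 1/2})"
  (is "?L = ?R")
proof
  have "x \<in> ?R" if "x \<in> ?L" for x
    using that
    by (intro image_eqI[of _ _ "(x $ 1, x $ 2, x $ 3)"]) (auto simp: cube_frame_def vec_eq_iff forall_3)
  then show "?L \<subseteq> ?R" by blast
  show "?R \<subseteq> ?L" by (auto simp: cube_frame_def forall_3)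
qed

text \<open>Mixed products cancel over the sign choices, and each squared coordinate occurs eight
  times with weight 1/4, so \<open>K = 2\<close>.\<close>

lemma symmetric_tight_frame_cube: "symmetric_tight_frame 2 cube_frame"
proof -
  have inj: "inj_on (\<lambda>(a, b, c). vector [a, b, c] :: real^3) D" for D
    by (auto simp: inj_on_def vec_eq_iff forall_3)
  have "(\<Sum>v\<in>cube_frame. (u \<bullet> v)\<^sup>2) = 2 * (norm u)\<^sup>2" for u
    unfolding cube_frame_eq sum.reindex[OF inj]
    by (simp add: inner_vec_def sum_3 power2_norm_eq_inner) (simp add: power2_eq_square field_simps)
  moreover have "uminus ` cube_frame = cube_frame"
  proof -
    have "x \<in> uminus ` cube_frame" if "x \<in> cube_frame" for x
      using that by (intro image_eqI[of _ _ "- x"]) (auto simp: cube_frame_def minus_equation_iff)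
    then show ?thesis by (auto simp: cube_frame_def)
  qed
  moreover have "finite cube_frame" by (simp add: cube_frame_eq)
  ultimately show ?thesis by (simp add: symmetric_tight_frame_def)
qed

lemma cube_frame_subset_sphere: "cube_frame \<subseteq> sphere 0 (sqrt (3/4))"
  by (auto simp: cube_frame_eq norm_vec_def L2_set_def sum_3 power2_eq_square)

lemma cbox_eq_hull_cube_frame:
  "cbox 0 One = convex hull ((+) ((1/2) *\<^sub>R One) ` cube_frame)"
proof -
  \<comment> \<open>The all-ones vector is written \<open>1\<close> so that coordinates simplify;
    \<open>Cart_1\<close> identifies it with \<open>One\<close> at the end.\<close>
  have "(+) ((1/2) *\<^sub>R 1) ` cube_frame = {x. \<forall>i. x $ i = 0 \<or> x $ i = 1}" (is "?L = ?R")
  proof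
    have "1/2 + t = 0 \<or> 1/2 + t = 1" if "t = 1/2 \<or> t = - 1/2" for t :: real
      using that by auto
    then show "?L \<subseteq> ?R" by (force simp: cube_frame_def)
    have "x \<in> ?L" if "x \<in> ?R" for x
      using that by (intro image_eqI[of _ _ "x - (1/2) *\<^sub>R 1"]) (auto simp: cube_frame_def)
    then show "?R \<subseteq> ?L" by blast
  qed
  moreover have "{x :: real^3. \<forall>b\<in>Basis. x \<bullet> b = 0 \<or> x \<bullet> b = 1} = {x. \<forall>i. x $ i = 0 \<or> x $ i = 1}"
    by (simp add: Basis_vec_def inner_axis)
  ultimately show ?thesis
    using unit_interval_convex_hull[where 'a="real^3"] by (simp only: Cart_1)
qed

section \<open>The locus for both solids\<close>

theorem theorem6p3:
  fixes S :: "(real^3) set" and A :: "nat \<Rightarrow> real^3" and n m :: nat and R c :: real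
  assumes "regular_octahedron S \<and> n = 6 \<or> cube S \<and> n = 8"
    and "bij_betw A {1..n} (vertices S)"
    and "R > 0" and "has_circumradius S R"
    and "m \<in> {2, 3}"
    and "c > real n * R ^ (2 * m)"
  shows "\<exists>r>0. {M. (\<Sum>i=1..n. dist M (A i) ^ (2 * m)) = c} = sphere (centroid S) r"
proof -
  \<comment> \<open>Both solids take the form of a similar copy of the hull of a translated frame.
    The octahedron has \<open>p = 0\<close> and \<open>r = 1\<close>; the cube has \<open>p\<close>
    at its centre \<open>(1/2) *\<^sub>R One\<close>.\<close>
  from assms(1) obtain f :: "real^3 \<Rightarrow> real^3" and K V r p
    where "similarity f" "symmetric_tight_frame K V" "V \<subseteq> sphere 0 r"
      "S = f ` (convex hull ((+) p ` V))"
  proof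
    assume "regular_octahedron S \<and> n = 6"
    then obtain f :: "real^3 \<Rightarrow> real^3"
      where f: "similarity f" "S = f ` (convex hull (Basis \<union> uminus ` Basis))"
      unfolding regular_octahedron_def by blast
    have "Basis \<union> uminus ` Basis \<subseteq> sphere (0 :: real^3) 1" by auto
    then show thesis
      using that[OF f(1) symmetric_tight_frame_octahedron, of 1 0] f(2) by (simp add: image_Un)
  next
    assume "cube S \<and> n = 8"
    then obtain f :: "real^3 \<Rightarrow> real^3" where f: "similarity f" "S = f ` cbox 0 One"
      unfolding cube_def by blast
    then show thesis
      using that[OF f(1) symmetric_tight_frame_cube cube_frame_subset_sphere]
        cbox_eq_hull_cube_frame by metis
  qed
  then obtain K W q where W: "symmetric_tight_frame K W" and S: "S = convex hull ((+) q ` W)"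
    and vertices: "vertices S = (+) q ` W"
    by (rule similarity_image_symmetric_tight_frame)
  obtain o' where "vertices S \<subseteq> sphere o' R"
    using assms(4) unfolding has_circumradius_def by blast
  \<comment> \<open>Links the given circumradius to the frame: the sphere containing the vertices
    must be centred at \<open>q\<close>.\<close>
  then have R: "norm v = R" if "v \<in> W" for v
    using norm_symmetric_tight_frame_in_sphere[OF W _ that] vertices by metis
  have "n = card (vertices S)" using bij_betw_same_card[OF assms(2)] by simp
  then have n: "n = card W" by (simp add: vertices card_image)
  have "(\<Sum>i=1..n. dist M (A i) ^ (2 * m)) = (\<Sum>v\<in>W. dist M (q + v) ^ (2 * m))" for M
  proof -
    have "(\<Sum>i=1..n. dist M (A i) ^ (2 * m)) = (\<Sum>x\<in>vertices S. dist M x ^ (2 * m))"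
      using assms(2) by (rule sum.reindex_bij_betw)
    then show ?thesis by (simp add: vertices sum.reindex)
  qed
  moreover have "centroid S = q" unfolding S by (rule centroid_symmetric_tight_frame[OF W])
  ultimately show ?thesis
    using level_set_symmetric_tight_frame[OF W R assms(5), of c q] assms(6) n by simp
qed

end
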